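(* Let $\mathcal{K}$ be the class of all finite simple $K_4$-minor-free graphs. Then the indeque ratio of $\mathcal{K}$ exists and equals one half: $${}^{\alpha}_{\omega}(\mathcal{K})=\lim_{n\to\infty}\frac{{}^{\alpha}_{\omega}(\mathcal{K},n)}{n}=\frac{1}{2}.$$
   Context: All graphs are finite and simple. A graph is $K_4$-minor-free if it does not contain the complete graph $K_4$ as a minor. For a graph $G$ and $S\subseteq V(G)$, let $G[S]$ denote the subgraph of $G$ induced by $S$. The set $S$ is an indeque set of $G$ if every connected component of $G[S]$ is a complete graph (a clique). The indeque number of $G$ is the maximum number of vertices in an indeque set, ${}^{\alpha}_{\omega}(G)=\max\{|S| : S\subseteq V(G),\ S \text{ is an indeque set of } G\}$. For a class $\mathcal{G}$ of graphs, ${}^{\alpha}_{\omega}(\mathcal{G},n)=\min\{{}^{\alpha}_{\omega}(G) : G\in\mathcal{G},\ |V(G)|=n\}$, and the indeque ratio of $\mathcal{G}$ is ${}^{\alpha}_{\omega}(\mathcal{G})=\lim_{n\to\infty}{}^{\alpha}_{\omega}(\mathcal{G},n)/n$. *)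

theory Defs
  imports Complex_Main "HOL-Library.Disjoint_Sets" "Graph_Theory.Kuratowski"
begin

text \<open>
  A finite simple graph is a \<^locale>\<open>pair_graph\<close>: a finite, loopfree, symmetric digraph whose arcs
  are pairs of vertices, so that an undirected edge is a pair of opposite arcs.
\<close>

text \<open>
  The name is qualified because \<^const>\<open>Topological_Spaces.connected\<close> is also in scope. The empty
  graph is not connected in this sense; hence it has no component, and the branch sets of a minor
  are nonempty.
\<close>

definition is_component :: "('a, 'b) pre_digraph \<Rightarrow> ('a, 'b) pre_digraph \<Rightarrow> bool" where
  "is_component G C \<longleftrightarrow> pre_digraph.max_subgraph G Digraph_Component.connected C"

definition is_clique :: "('a, 'b) pre_digraph \<Rightarrow> bool" where
  "is_clique C \<longleftrightarrow> (\<exists>k. K\<^bsub>k\<^esub> C)"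

text \<open>\<open>B x\<close> is the branch set of \<open>x\<close>: the vertices of \<open>G\<close> contracted onto the vertex \<open>x\<close> of \<open>H\<close>.\<close>

definition minor :: "('a, 'b) pre_digraph \<Rightarrow> ('c, 'd) pre_digraph \<Rightarrow> bool" where
  "minor H G \<longleftrightarrow> (\<exists>B.
     (\<forall>x \<in> verts H. B x \<subseteq> verts G \<and> Digraph_Component.connected (G \<restriction> B x)) \<and>
     disjoint_family_on B (verts H) \<and>
     (\<forall>x y. x \<rightarrow>\<^bsub>H\<^esub> y \<longrightarrow> (\<exists>u \<in> B x. \<exists>v \<in> B y. u \<rightarrow>\<^bsub>G\<^esub> v)))"

definition K4_minor_free :: "('a, 'b) pre_digraph \<Rightarrow> bool" where
  "K4_minor_free G \<longleftrightarrow> \<not> (\<exists>H :: nat pair_pre_digraph. K\<^bsub>4\<^esub> (with_proj H) \<and> minor (with_proj H) G)"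

definition indeque_set :: "'a pair_pre_digraph \<Rightarrow> 'a set \<Rightarrow> bool" where
  "indeque_set G S \<longleftrightarrow>
     S \<subseteq> pverts G \<and> (\<forall>C. is_component (with_proj G \<restriction> S) C \<longrightarrow> is_clique C)"

definition indeque_number :: "'a pair_pre_digraph \<Rightarrow> nat" where
  "indeque_number G = Max {card S | S. indeque_set G S}"

text \<open>
  A class of graphs is a set of graphs with vertices in \<^typ>\<open>nat\<close>; every finite graph is isomorphic
  to one of these. The minimum below ranges over finitely many values, since
  \<open>indeque_number G \<le> n\<close> when \<open>G\<close> has \<open>n\<close> vertices.
\<close>

definition class_indeque_number :: "nat pair_pre_digraph set \<Rightarrow> nat \<Rightarrow> nat" where
  "class_indeque_number \<G> n = Min {indeque_number G | G. G \<in> \<G> \<and> card (pverts G) = n}"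

text \<open>Only meaningful when the limit exists.\<close>

definition indeque_ratio :: "nat pair_pre_digraph set \<Rightarrow> real" where
  "indeque_ratio \<G> = lim (\<lambda>n. real (class_indeque_number \<G> n) / real n)"

definition K4_minor_free_graphs :: "nat pair_pre_digraph set" where
  "K4_minor_free_graphs = {G. pair_graph G \<and> K4_minor_free (with_proj G)}"

end

theory Submission
  imports Defs
begin

text \<open>
  The value 1/2 cannot be exceeded because of disjoint unions of 4-cycles: three vertices of a
  4-cycle induce a path, which is not a clique, so an indeque set contains at most half of each
  cycle. The substance is the opposite bound: every \<open>K\<^sub>4\<close>-minor-free graph on \<open>n\<close> vertices has an
  indeque set with at least \<open>n / 2\<close> vertices. One can even ask that the set induces maximum degree
  at most 1. Such a set, called dissociated here, has components with one or two vertices, hence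
  cliques.

  A nonempty dissociated set \<open>I\<close> with at most \<open>|I|\<close> outside neighbours can be split off:
  delete \<open>I\<close> together with its neighbours, solve the rest by induction, and put \<open>I\<close> back. A graph with
  such a set is called reducible, and only irreducible graphs need an argument. An irreducible graph
  for which smaller graphs are already solved is connected, because a solution of a union of
  components would be such a set.

  In a connected graph, consider a piece \<open>H\<close> between two terminals \<open>u\<close> and \<open>w\<close>: the neighbours of \<open>H\<close>
  lie in \<open>H \<union> {u, w}\<close>, and \<open>u\<close> and \<open>w\<close> are joined outside \<open>H\<close>. In the absence of a \<open>K\<^sub>4\<close> minor,
  a nonempty piece is the union of two nonempty pieces with the same terminals (parallel), or it has
  a vertex \<open>x\<close> such that the rest consists of a piece between \<open>u\<close> and \<open>x\<close> and one between \<open>x\<close> and \<open>w\<close>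
  (series); either of the latter two may be empty. This is \<open>piece_decomposition\<close>. It rests on
  \<open>single_separating_vertex\<close>: if no single vertex of \<open>H\<close> separated \<open>u\<close> from \<open>w\<close> within \<open>H\<close>, two
  disjoint connections between them and a link joining the two would form a \<open>K\<^sub>4\<close> minor together
  with the outside.

  Induction along this decomposition shows (\<open>irreducible_piece\<close>) that a nonempty piece \<open>H\<close> of an
  irreducible graph has, for either terminal \<open>t\<close>, a subset \<open>I\<close> with \<open>2|I| \<ge> |H| + 1\<close> such that
  \<open>I \<union> {t}\<close> is dissociated. Two nonempty pieces in parallel would give \<open>2|I| \<ge> |H| + 2\<close>, and then \<open>I\<close>
  could be split off, since at most \<open>|H| + 2 - |I|\<close> vertices outside \<open>I\<close> are adjacent to it. For the same
  reason, a series composition cannot have exactly one empty side, because \<open>x\<close> could be added to the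
  set of the other side. If both sides are empty, \<open>I = {x}\<close> works; if neither is, leaving out \<open>x\<close>
  and uniting the two sets works. Applied to the piece between the ends of an edge \<open>uw\<close> that
  contains all other vertices, the set \<open>I \<union> {u}\<close> has at least half of all vertices.
\<close>

section \<open>Connected vertex sets\<close>

definition conn_set :: "'a rel \<Rightarrow> 'a set \<Rightarrow> bool" where
  "conn_set E A \<longleftrightarrow> A \<noteq> {} \<and> (\<forall>a \<in> A. \<forall>b \<in> A. (a, b) \<in> rtrancl_on A E)"

definition touches :: "'a rel \<Rightarrow> 'a set \<Rightarrow> 'a set \<Rightarrow> bool" where
  "touches E A B \<longleftrightarrow> (\<exists>a \<in> A. \<exists>b \<in> B. (a, b) \<in> E)"

definition comp_of :: "'a rel \<Rightarrow> 'a set \<Rightarrow> 'a \<Rightarrow> 'a set" where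
  "comp_of E A a = {b. (a, b) \<in> rtrancl_on A E}"

text \<open>
  A graph enters the combinatorial part only through its edge relation; its vertex set is a parameter
  of the statements, so that passing to an induced subgraph changes nothing but that parameter.
\<close>

locale edge_relation =
  fixes E :: "'a rel"
  assumes sym_edges: "sym E" and irrefl_edges: "irrefl E"
begin

lemma edge_sym: "(a, b) \<in> E \<Longrightarrow> (b, a) \<in> E"
  using sym_edges by (rule symD)

lemma edge_neq: "(a, b) \<in> E \<Longrightarrow> a \<noteq> b"
  using irrefl_edges by (auto simp: irrefl_def)

lemma walk_sym: "(a, b) \<in> rtrancl_on A E \<Longrightarrow> (b, a) \<in> rtrancl_on A E"
  using rtrancl_on_sym[OF sym_edges] by (rule symD)

lemma walk_mono: "(a, b) \<in> rtrancl_on A E \<Longrightarrow> A \<subseteq> B \<Longrightarrow> (a, b) \<in> rtrancl_on B E"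
  by (rule rtrancl_on_mono) auto

lemma walk_edge: "(a, b) \<in> E \<Longrightarrow> a \<in> A \<Longrightarrow> b \<in> A \<Longrightarrow> (a, b) \<in> rtrancl_on A E"
  by (meson rtrancl_on.intros)

lemma touches_sym: "touches E A B \<Longrightarrow> touches E B A"
  unfolding touches_def using edge_sym by blast

lemma touches_mono: "touches E A B \<Longrightarrow> A \<subseteq> A' \<Longrightarrow> B \<subseteq> B' \<Longrightarrow> touches E A' B'"
  unfolding touches_def by blast

lemma walk_leaves_set:
  assumes "(a, b) \<in> rtrancl_on A E" "a \<in> X" "b \<notin> X"
  shows "\<exists>x \<in> X \<inter> A. \<exists>y \<in> A - X. (x, y) \<in> E"
  using assms by (induction rule: rtrancl_on_induct) auto

lemma conn_set_crosses_cut: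
  assumes "conn_set E A" "X \<subseteq> A" "X \<noteq> {}" "X \<noteq> A"
  shows "\<exists>x \<in> X. \<exists>y \<in> A - X. (x, y) \<in> E"
proof -
  obtain a b where "a \<in> X" "b \<in> A" "b \<notin> X" using assms by blast
  then show ?thesis using walk_leaves_set[of a b A X] assms unfolding conn_set_def by blast
qed

lemma conn_set_singleton: "conn_set E {a}"
  by (auto simp: conn_set_def)

lemma comp_of_subset: "comp_of E A a \<subseteq> A"
  by (auto simp: comp_of_def dest: in_rtrancl_on_in_F)

lemma comp_of_self: "a \<in> A \<Longrightarrow> a \<in> comp_of E A a"
  by (auto simp: comp_of_def)

lemma comp_of_closed: "b \<in> comp_of E A a \<Longrightarrow> (b, c) \<in> E \<Longrightarrow> c \<in> A \<Longrightarrow> c \<in> comp_of E A a"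
  by (auto simp: comp_of_def intro: rtrancl_on_into_rtrancl_on)

lemma conn_set_comp_of:
  assumes "a \<in> A" shows "conn_set E (comp_of E A a)"
proof -
  have to: "(a, b) \<in> rtrancl_on (comp_of E A a) E" if "b \<in> comp_of E A a" for b
  proof -
    have "(a, b) \<in> rtrancl_on A E" using that by (simp add: comp_of_def)
    then show ?thesis
    proof (induction rule: rtrancl_on_induct)
      case base then show ?case using assms by (auto intro: comp_of_self)
    next
      case (step y z)
      then show ?case
        by (auto simp: comp_of_def intro: rtrancl_on_into_rtrancl_on)
    qed
  qed
  show ?thesis unfolding conn_set_def
    using to walk_sym rtrancl_on_trans comp_of_self[OF assms] by (metis empty_iff)
qed

lemma conn_set_subset_comp_of:
  "conn_set E C \<Longrightarrow> C \<subseteq> A \<Longrightarrow> c \<in> C \<Longrightarrow> C \<subseteq> comp_of E A c"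
  by (auto simp: comp_of_def conn_set_def intro: walk_mono)

lemma comp_of_eq:
  assumes "(a, b) \<in> rtrancl_on A E" shows "comp_of E A a = comp_of E A b"
  using rtrancl_on_trans[OF assms] rtrancl_on_trans[OF walk_sym[OF assms]]
  by (auto simp: comp_of_def)

lemma not_conn_setE:
  assumes "\<not> conn_set E A" "a \<in> A"
  obtains X where "X \<subseteq> A" "X \<noteq> {}" "a \<notin> X" "\<not> touches E X (A - X)"
proof
  let ?C = "comp_of E A a"
  show "A - ?C \<noteq> {}"
    using conn_set_comp_of[OF assms(2)] assms(1) comp_of_subset[of A a] by (metis Diff_eq_empty_iff equalityI)
  show "\<not> touches E (A - ?C) (A - (A - ?C))"
    unfolding touches_def using comp_of_closed edge_sym by blast
qed (use assms comp_of_self in auto)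

lemma conn_set_Un:
  assumes A: "conn_set E A" and B: "conn_set E B" and AB: "touches E A B"
  shows "conn_set E (A \<union> B)"
proof (rule ccontr)
  assume n: "\<not> conn_set E (A \<union> B)"
  from AB obtain a b where ab: "a \<in> A" "b \<in> B" "(a, b) \<in> E" by (auto simp: touches_def)
  obtain X where X: "X \<subseteq> A \<union> B" "X \<noteq> {}" "a \<notin> X" "\<not> touches E X (A \<union> B - X)"
    using not_conn_setE[OF n, of a] ab by blast
  have "X \<inter> A = {}"
    using conn_set_crosses_cut[OF A, of "X \<inter> A"] X ab unfolding touches_def by blast
  moreover have "b \<notin> X" using X ab edge_sym unfolding touches_def by blast
  then have "X \<inter> B = {}"
    using conn_set_crosses_cut[OF B, of "X \<inter> B"] X ab unfolding touches_def by blast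
  ultimately show False using X by blast
qed

end


section \<open>Models of \<open>K\<^sub>4\<close> and separating vertices\<close>

definition K4_model :: "'a rel \<Rightarrow> 'a set \<Rightarrow> 'a set \<Rightarrow> 'a set \<Rightarrow> 'a set \<Rightarrow> bool" where
  "K4_model E A B C D \<longleftrightarrow>
     conn_set E A \<and> conn_set E B \<and> conn_set E C \<and> conn_set E D \<and>
     A \<inter> B = {} \<and> A \<inter> C = {} \<and> A \<inter> D = {} \<and> B \<inter> C = {} \<and> B \<inter> D = {} \<and> C \<inter> D = {} \<and>
     touches E A B \<and> touches E A C \<and> touches E A D \<and>
     touches E B C \<and> touches E B D \<and> touches E C D"

definition no_K4_model :: "'a rel \<Rightarrow> 'a set \<Rightarrow> bool" where
  "no_K4_model E V \<longleftrightarrow> \<not> (\<exists>A B C D. A \<union> B \<union> C \<union> D \<subseteq> V \<and> K4_model E A B C D)"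

context edge_relation
begin

text \<open>
  This is Menger's theorem for two connections, in a form suited to branch sets. Start with any
  vertex \<open>z\<close> of \<open>H\<close> next to \<open>U\<close>. If \<open>z\<close> does not separate, one component \<open>C\<close> of \<open>H - {z}\<close> still reaches
  both sides. Then \<open>R = H - C\<close> is connected and touches \<open>U\<close> and \<open>C\<close>, so it cannot touch \<open>W\<close>: otherwise
  \<open>R\<close>, \<open>C\<close>, \<open>U\<close>, \<open>W\<close> would be a model of \<open>K\<^sub>4\<close>. Absorbing \<open>R\<close> into \<open>U\<close> leaves the smaller set \<open>C\<close>, and a
  vertex that separates inside \<open>C\<close> also separates inside \<open>H\<close>, as \<open>W\<close> is only reachable through \<open>C\<close>.
\<close>

lemma single_separating_vertex:
  assumes "no_K4_model E V" "finite H" "conn_set E H" "conn_set E U" "conn_set E W"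
    and "H \<union> U \<union> W \<subseteq> V" "H \<inter> U = {}" "H \<inter> W = {}" "U \<inter> W = {}"
    and "touches E U W" "touches E H U" "touches E H W"
  shows "\<exists>x \<in> H. \<forall>C \<subseteq> H - {x}. conn_set E C \<longrightarrow> \<not> (touches E C U \<and> touches E C W)"
  using assms(2-)
proof (induction "card H" arbitrary: H U rule: less_induct)
  case less
  note fin = less.prems(1) and H = less.prems(2) and U = less.prems(3) and W = less.prems(4)
    and sub = less.prems(5) and HU = less.prems(6) and HW = less.prems(7) and UW = less.prems(8)
    and tUW = less.prems(9) and tHU = less.prems(10) and tHW = less.prems(11)
  from tHU obtain z u where z: "z \<in> H" "u \<in> U" "(z, u) \<in> E" by (auto simp: touches_def)
  show ?case
  proof (cases "\<forall>C \<subseteq> H - {z}. conn_set E C \<longrightarrow> \<not> (touches E C U \<and> touches E C W)")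
    case True
    with z show ?thesis by blast
  next
    case False
    then obtain C0 c where C0: "C0 \<subseteq> H - {z}" "conn_set E C0" "touches E C0 U" "touches E C0 W" "c \<in> C0"
      by (auto simp: conn_set_def)
    define C where "C = comp_of E (H - {z}) c"
    define R where "R = H - C"
    have "C0 \<subseteq> C" unfolding C_def by (rule conn_set_subset_comp_of) (use C0 in auto)
    then have tCU: "touches E C U" and tCW: "touches E C W" and c: "c \<in> C"
      using C0 touches_mono by blast+
    have C: "conn_set E C" unfolding C_def by (rule conn_set_comp_of) (use C0 in auto)
    have CH: "C \<subseteq> H - {z}" unfolding C_def by (rule comp_of_subset)
    have closed: "y = z" if "x \<in> C" "(x, y) \<in> E" "y \<in> H - C" for x y
      using comp_of_closed[of x "H - {z}" c y] that unfolding C_def by blast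
    have zR: "z \<in> R" using CH z by (auto simp: R_def)
    have tCR: "touches E C R"
      using conn_set_crosses_cut[OF H, of C] CH c zR unfolding touches_def R_def by blast
    have R: "conn_set E R"
    proof (rule ccontr)
      assume "\<not> conn_set E R"
      then obtain X where X: "X \<subseteq> R" "X \<noteq> {}" "z \<notin> X" "\<not> touches E X (R - X)"
        using zR by (rule not_conn_setE)
      obtain x y where xy: "x \<in> X" "y \<in> H - X" "(x, y) \<in> E"
        using conn_set_crosses_cut[OF H, of X] X z unfolding R_def by blast
      then have "y \<in> C" using X unfolding touches_def R_def by blast
      then have "x = z" using closed[of y x] xy X edge_sym unfolding R_def by blast
      with xy X show False by blast
    qed
    have RC: "R \<inter> C = {}" "R \<subseteq> H" "H = R \<union> C" using CH unfolding R_def by auto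
    have tRU: "touches E R U" using z zR unfolding touches_def by blast
    have nRW: "\<not> touches E R W"
    proof
      assume "touches E R W"
      then have "K4_model E R C U W"
        unfolding K4_model_def using R C U W RC HU HW UW tRU touches_sym[OF tCR] tCU tCW tUW by blast
      then show False using assms(1) sub RC unfolding no_K4_model_def by blast
    qed
    have "\<exists>x \<in> C. \<forall>D \<subseteq> C - {x}. conn_set E D \<longrightarrow> \<not> (touches E D (U \<union> R) \<and> touches E D W)"
    proof (rule less.hyps)
      show "card C < card H" using CH z fin by (intro psubset_card_mono) auto
      show "finite C" using RC fin finite_subset by blast
      show "conn_set E (U \<union> R)" using conn_set_Un[OF U R] touches_sym[OF tRU] by blast
      show "touches E (U \<union> R) W" "touches E C (U \<union> R)" using tUW tCU touches_mono by blast+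
    qed (use C W sub RC HU HW UW tCW in blast)+
    then obtain x where x: "x \<in> C"
      "\<And>D. D \<subseteq> C - {x} \<Longrightarrow> conn_set E D \<Longrightarrow> touches E D (U \<union> R) \<Longrightarrow> touches E D W \<Longrightarrow> False" by blast
    have False if D0: "D0 \<subseteq> H - {x}" "conn_set E D0" "touches E D0 U" "touches E D0 W" for D0
    proof -
      obtain d w where d: "d \<in> D0" "w \<in> W" "(d, w) \<in> E" using D0 by (auto simp: touches_def)
      then have dC: "d \<in> C - {x}" using nRW D0 RC unfolding touches_def by blast
      define D where "D = comp_of E (C - {x}) d"
      have D: "D \<subseteq> C - {x}" "conn_set E D" "d \<in> D"
        unfolding D_def using comp_of_subset conn_set_comp_of[OF dC] comp_of_self[OF dC] by auto
      have "touches E D W" using d D unfolding touches_def by blast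
      moreover have "touches E D (U \<union> R)"
      proof (cases "D0 \<subseteq> D")
        case True then show ?thesis using D0 touches_mono by blast
      next
        case False
        then obtain a b where ab: "a \<in> D0 \<inter> D" "b \<in> D0 - D" "(a, b) \<in> E"
          using conn_set_crosses_cut[OF D0(2), of "D0 \<inter> D"] d D by blast
        then have "b \<notin> C - {x}" using comp_of_closed[of a "C - {x}" d b] unfolding D_def by blast
        then have "b \<in> R" using ab D0 RC by blast
        with ab show ?thesis unfolding touches_def by blast
      qed
      ultimately show False using x D by blast
    qed
    then show ?thesis using x RC by blast
  qed
qed

text \<open>
  A walk that stops at its first visit to \<open>u\<close> gives a branch set for \<open>w\<close> that leaves \<open>u\<close> free to be a
  branch set of its own.
\<close>

lemma conn_set_up_to:
  assumes "(w, u) \<in> rtrancl_on Q E" "w \<noteq> u"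
  shows "\<exists>W \<subseteq> Q - {u}. conn_set E W \<and> w \<in> W \<and> touches E W {u}"
  using assms
proof (induction rule: converse_rtrancl_on_induct)
  case base then show ?case by simp
next
  case (step x y)
  show ?case
  proof (cases "y = u")
    case True
    then show ?thesis using step conn_set_singleton[of x]
      by (intro exI[of _ "{x}"]) (auto simp: touches_def)
  next
    case False
    then obtain W where W: "W \<subseteq> Q - {u}" "conn_set E W" "y \<in> W" "touches E W {u}" using step by blast
    have "conn_set E ({x} \<union> W)"
      using conn_set_singleton W(2) by (rule conn_set_Un) (use step W in \<open>auto simp: touches_def\<close>)
    moreover have "touches E ({x} \<union> W) {u}" using W touches_mono by blast
    ultimately show ?thesis using W step by (intro exI[of _ "{x} \<union> W"]) auto
  qed
qed

end


section \<open>Two-terminal pieces\<close>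

text \<open>
  The connection of \<open>u\<close> and \<open>w\<close> outside \<open>H\<close> plays the part of a virtual edge between the terminals:
  it can be contracted onto them in a search for minors, and it passes to smaller pieces without a
  change of the graph.
\<close>

definition piece :: "'a rel \<Rightarrow> 'a set \<Rightarrow> 'a \<Rightarrow> 'a \<Rightarrow> 'a set \<Rightarrow> bool" where
  "piece E V u w H \<longleftrightarrow>
     H \<subseteq> V \<and> u \<notin> H \<and> w \<notin> H \<and> u \<noteq> w \<and> E `` H \<inter> V \<subseteq> H \<union> {u, w} \<and>
     (u, w) \<in> rtrancl_on (V - H) E"

context edge_relation
begin

lemma pieceD:
  assumes "piece E V u w H"
  shows "H \<subseteq> V" "u \<notin> H" "w \<notin> H" "u \<noteq> w" "u \<in> V" "w \<in> V"
    "\<And>a b. a \<in> H \<Longrightarrow> (a, b) \<in> E \<Longrightarrow> b \<in> V \<Longrightarrow> b \<in> H \<or> b = u \<or> b = w"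
    "(u, w) \<in> rtrancl_on (V - H) E"
  using assms in_rtrancl_on_in_F[of u w "V - H" E] unfolding piece_def by blast+

lemma pieceI:
  assumes "H \<subseteq> V" "u \<notin> H" "w \<notin> H" "u \<noteq> w"
    and "\<And>a b. a \<in> H \<Longrightarrow> (a, b) \<in> E \<Longrightarrow> b \<in> V \<Longrightarrow> b \<in> H \<or> b = u \<or> b = w"
    and "(u, w) \<in> rtrancl_on (V - H) E"
  shows "piece E V u w H"
  using assms unfolding piece_def by blast

text \<open>
  Outside \<open>H\<close>, the terminal \<open>u\<close> and a walk from \<open>w\<close> up to a neighbour of \<open>u\<close> serve as the two touching
  branch sets.
\<close>

lemma piece_separating_vertex:
  assumes "no_K4_model E V" "finite V" "piece E V u w H" "conn_set E H"
    and "touches E H {u}" "touches E H {w}"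
  shows "\<exists>x \<in> H. \<forall>C \<subseteq> H - {x}. conn_set E C \<longrightarrow> \<not> (touches E C {u} \<and> touches E C {w})"
proof -
  note p = pieceD[OF assms(3)]
  obtain W where W: "W \<subseteq> V - H - {u}" "conn_set E W" "w \<in> W" "touches E W {u}"
    using conn_set_up_to[OF walk_sym[OF p(8)]] p(4) by blast
  have to_W: "touches E C W" if "touches E C {w}" for C
    using touches_mono[OF that] W(3) by simp
  have "\<exists>x \<in> H. \<forall>C \<subseteq> H - {x}. conn_set E C \<longrightarrow> \<not> (touches E C {u} \<and> touches E C W)"
    using assms(1) _ assms(4) conn_set_singleton W(2)
  proof (rule single_separating_vertex)
    show "finite H" using p(1) assms(2) by (rule finite_subset)
    show "touches E {u} W" using W touches_sym by blast
    show "touches E H W" using to_W assms(6) by blast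
  qed (use assms(5) p(1-3,5) W(1) in auto)
  then show ?thesis using to_W by blast
qed

text \<open>
  In a series decomposition, \<open>w\<close> reaches the separating vertex \<open>x\<close> through the side \<open>H2\<close> that it belongs
  to. This is what makes the other side \<open>H1\<close> a piece with terminal \<open>x\<close>.
\<close>

lemma walk_to_separator:
  assumes H: "conn_set E H" "H = insert x (H1 \<union> H2)" and h: "h \<in> H" "(h, w) \<in> E"
    and "h \<notin> H1" "H \<subseteq> V" "w \<in> V" "w \<notin> H" "x \<notin> H1" "x \<notin> H2" "H1 \<inter> H2 = {}"
    and no_edge: "\<And>a b. a \<in> H1 \<Longrightarrow> b \<in> H2 \<Longrightarrow> (a, b) \<notin> E"
  shows "(w, x) \<in> rtrancl_on (V - H1) E"
proof (cases "h = x")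
  case True
  then show ?thesis using assms edge_sym by (intro walk_edge) auto
next
  case False
  define Z where "Z = {y \<in> H2. (w, y) \<in> rtrancl_on (V - H1) E}"
  have "h \<in> H2" using assms False by blast
  moreover have "(w, h) \<in> rtrancl_on (V - H1) E"
    using assms edge_sym by (intro walk_edge) auto
  ultimately have "h \<in> Z" unfolding Z_def by blast
  then obtain y y' where y: "y \<in> Z" "y' \<in> H - Z" "(y, y') \<in> E"
    using conn_set_crosses_cut[OF H(1), of Z] assms unfolding Z_def by blast
  have "y' \<notin> H1" using y no_edge[of y' y] edge_sym unfolding Z_def by blast
  then have "(w, y') \<in> rtrancl_on (V - H1) E"
    using y assms unfolding Z_def by (auto intro: rtrancl_on_into_rtrancl_on)
  moreover have "y' = x" using calculation y \<open>y' \<notin> H1\<close> H(2) unfolding Z_def by blast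
  ultimately show ?thesis by simp
qed

text \<open>
  Connectedness of the whole graph ensures that a connected \<open>H\<close> is next to at least one terminal. If
  it is next to only one of them, every vertex separates; \<open>x\<close> is then taken to be a neighbour of that
  terminal, which supplies the connection between \<open>x\<close> and that terminal that the pieces require.
\<close>

lemma piece_decomposition:
  assumes K: "no_K4_model E V" and fin: "finite V" and V: "conn_set E V"
    and P: "piece E V u w H" and ne: "H \<noteq> {}"
  obtains
    (parallel) H1 H2 where "H1 \<noteq> {}" "H2 \<noteq> {}" "H1 \<inter> H2 = {}" "H = H1 \<union> H2"
      "piece E V u w H1" "piece E V u w H2"
  | (series) x H1 H2 where "x \<notin> H1" "x \<notin> H2" "H1 \<inter> H2 = {}" "H = insert x (H1 \<union> H2)"
      "piece E V u x H1" "piece E V x w H2"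
proof (cases "conn_set E H")
  case False
  note p = pieceD[OF P]
  from ne obtain a where "a \<in> H" by blast
  with False obtain X where X: "X \<subseteq> H" "X \<noteq> {}" "a \<notin> X" "\<not> touches E X (H - X)" by (rule not_conn_setE)
  have walk: "(u, w) \<in> rtrancl_on (V - X) E" "(u, w) \<in> rtrancl_on (V - (H - X)) E"
    by (rule walk_mono[OF p(8)], use X(1) in blast)+
  have no_edge: "(b, c) \<notin> E" "(c, b) \<notin> E" if "b \<in> X" "c \<in> H - X" for b c
    using X(4) that edge_sym[of c b] unfolding touches_def by blast+
  have "piece E V u w X"
  proof (rule pieceI)
    show "b \<in> X \<or> b = u \<or> b = w" if "c \<in> X" "(c, b) \<in> E" "b \<in> V" for c b
      using p(7)[of c b] that X(1) no_edge[of c b] by blast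
  qed (use p X(1) walk in auto)
  moreover have "piece E V u w (H - X)"
  proof (rule pieceI)
    show "b \<in> H - X \<or> b = u \<or> b = w" if "c \<in> H - X" "(c, b) \<in> E" "b \<in> V" for c b
      using p(7)[of c b] that no_edge(2)[of b c] by blast
  qed (use p X(1) walk in auto)
  ultimately show ?thesis using parallel[of X "H - X"] X \<open>a \<in> H\<close> by blast
next
  case H: True
  note p = pieceD[OF P]
  have tuw: "touches E H {u} \<or> touches E H {w}"
    using conn_set_crosses_cut[OF V p(1) ne] p unfolding touches_def by blast
  have "\<exists>x \<in> H. (\<forall>C \<subseteq> H - {x}. conn_set E C \<longrightarrow> \<not> (touches E C {u} \<and> touches E C {w})) \<and>
    (touches E H {u} \<or> (w, x) \<in> E) \<and> (touches E H {w} \<or> (u, x) \<in> E)"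
  proof (cases "touches E H {u} \<and> touches E H {w}")
    case True
    then show ?thesis using piece_separating_vertex[OF K fin P H] by blast
  next
    case False
    then obtain x where "x \<in> H" "touches E H {u} \<and> (u, x) \<in> E \<or> touches E H {w} \<and> (w, x) \<in> E"
      using tuw edge_sym unfolding touches_def by blast
    then show ?thesis using False touches_mono by blast
  qed
  then obtain x where x: "x \<in> H"
    "\<And>C. C \<subseteq> H - {x} \<Longrightarrow> conn_set E C \<Longrightarrow> touches E C {u} \<Longrightarrow> touches E C {w} \<Longrightarrow> False"
    "touches E H {u} \<or> (w, x) \<in> E" "touches E H {w} \<or> (u, x) \<in> E" by blast
  \<comment> \<open>\<open>H1\<close> collects the components of \<open>H - {x}\<close> next to \<open>u\<close>; all others may go to the side of \<open>w\<close>.\<close>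
  define H1 where "H1 = {y \<in> H - {x}. touches E (comp_of E (H - {x}) y) {u}}"
  define H2 where "H2 = H - {x} - H1"
  have split: "H = insert x (H1 \<union> H2)" "x \<notin> H1" "x \<notin> H2" "H1 \<inter> H2 = {}"
    using x(1) unfolding H1_def H2_def by auto
  have uH2: "(y, u) \<notin> E" if "y \<in> H2" for y
    using that comp_of_self[of y "H - {x}"] unfolding H1_def H2_def touches_def by blast
  have wH1: "(y, w) \<notin> E" if "y \<in> H1" for y
  proof
    assume "(y, w) \<in> E"
    then have "touches E (comp_of E (H - {x}) y) {w}"
      using that comp_of_self[of y "H - {x}"] unfolding H1_def touches_def by blast
    then show False
      using x(2)[of "comp_of E (H - {x}) y"] that comp_of_subset conn_set_comp_of unfolding H1_def by blast
  qed
  have same: "comp_of E (H - {x}) a = comp_of E (H - {x}) b"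
    if "a \<in> H - {x}" "b \<in> H - {x}" "(a, b) \<in> E" for a b
    using walk_edge[OF that(3,1,2)] by (rule comp_of_eq)
  have H12: "(a, b) \<notin> E" if "a \<in> H1" "b \<in> H2" for a b
    using same[of a b] that unfolding H1_def H2_def by auto
  have uxH1: "(u, x) \<in> rtrancl_on (V - H1) E"
  proof (cases "(u, x) \<in> E")
    case True
    then show ?thesis using p x split by (intro walk_edge) auto
  next
    case False
    with x(4) obtain h where h: "h \<in> H" "(h, w) \<in> E" unfolding touches_def by blast
    have "h \<notin> H1" using wH1 h by blast
    with H split(1) h have "(w, x) \<in> rtrancl_on (V - H1) E"
      by (rule walk_to_separator) (use p(1-6) split H12 in auto)
    moreover have "(u, w) \<in> rtrancl_on (V - H1) E" using p(8) split by (auto intro: walk_mono)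
    ultimately show ?thesis by (metis rtrancl_on_trans)
  qed
  have xwH2: "(x, w) \<in> rtrancl_on (V - H2) E"
  proof (cases "(w, x) \<in> E")
    case True
    then show ?thesis using p x split by (intro walk_sym[OF walk_edge]) auto
  next
    case False
    with x(3) obtain h where h: "h \<in> H" "(h, u) \<in> E" unfolding touches_def by blast
    have H': "H = insert x (H2 \<union> H1)" using split(1) by blast
    have no_edge: "(a, b) \<notin> E" if "a \<in> H2" "b \<in> H1" for a b
      using H12[OF that(2,1)] edge_sym[of a b] by blast
    have "h \<notin> H2" using uH2 h by blast
    with H H' h have "(u, x) \<in> rtrancl_on (V - H2) E"
      by (rule walk_to_separator) (use p(1-6) split no_edge in auto)
    moreover have "(u, w) \<in> rtrancl_on (V - H2) E" using p(8) split by (auto intro: walk_mono)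
    ultimately show ?thesis by (metis rtrancl_on_trans walk_sym)
  qed
  have "piece E V u x H1"
  proof (rule pieceI)
    show "b \<in> H1 \<or> b = u \<or> b = x" if "c \<in> H1" "(c, b) \<in> E" "b \<in> V" for c b
      using p(7)[of c b] that split wH1[of c] H12[of c b] by blast
  qed (use p x(1) split uxH1 in auto)
  moreover have "piece E V x w H2"
  proof (rule pieceI)
    show "b \<in> H2 \<or> b = x \<or> b = w" if "c \<in> H2" "(c, b) \<in> E" "b \<in> V" for c b
      using p(7)[of c b] that split uH2[of c] H12[of b c] edge_sym[of c b] by blast
  qed (use p x(1) split xwH2 in auto)
  ultimately show ?thesis by (rule series[OF split(2,3,4,1)])
qed

end


section \<open>Dissociated sets\<close>

text \<open>In other words, every vertex of \<open>S\<close> has at most one neighbour in \<open>S\<close>.\<close>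

definition dissociated :: "'a rel \<Rightarrow> 'a set \<Rightarrow> bool" where
  "dissociated E S \<longleftrightarrow> (\<forall>a \<in> S. \<forall>b \<in> S. \<forall>c \<in> S. (a, b) \<in> E \<longrightarrow> (a, c) \<in> E \<longrightarrow> b = c)"

text \<open>
  Removing \<open>I\<close> and its outside neighbours deletes at most \<open>2|I|\<close> vertices, of which the \<open>|I|\<close> vertices of
  \<open>I\<close> can be added to any solution of the rest.
\<close>

definition reducible :: "'a rel \<Rightarrow> 'a set \<Rightarrow> bool" where
  "reducible E V \<longleftrightarrow>
     (\<exists>I \<subseteq> V. I \<noteq> {} \<and> dissociated E I \<and> card (E `` I \<inter> V - I) \<le> card I)"

context edge_relation
begin

lemma dissociated_mono: "dissociated E T \<Longrightarrow> S \<subseteq> T \<Longrightarrow> dissociated E S"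
  unfolding dissociated_def by blast

lemma dissociated_Un:
  assumes "dissociated E S" "dissociated E T" "\<And>a b. a \<in> S \<Longrightarrow> b \<in> T \<Longrightarrow> (a, b) \<notin> E"
  shows "dissociated E (S \<union> T)"
  using assms edge_sym unfolding dissociated_def by (smt (verit, best) Un_iff)

lemma dissociated_pair: "dissociated E {a, b}"
  unfolding dissociated_def using edge_neq by blast

lemma heavy_piece_reducible:
  assumes P: "piece E V u w H" and fin: "finite V"
    and I: "I \<subseteq> H" "dissociated E I" "card H + 2 \<le> 2 * card I"
  shows "reducible E V"
proof -
  note p = pieceD[OF P]
  have finH: "finite H" using p(1) fin by (rule finite_subset)
  have "card (E `` I \<inter> V - I) \<le> card (H \<union> {u, w} - I)"
    using p(7) I(1) finH by (intro card_mono) auto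
  also have "\<dots> = card (H \<union> {u, w}) - card I"
    using I(1) finH by (intro card_Diff_subset) (auto intro: finite_subset)
  also have "card (H \<union> {u, w}) \<le> card H + 2"
    using p finH by simp
  finally have "card (E `` I \<inter> V - I) \<le> card I" using I(3) by linarith
  moreover have "I \<noteq> {}" using I(3) by auto
  ultimately show ?thesis unfolding reducible_def using I p(1) by blast
qed

text \<open>
  The surplus of 1 in the bound is what the induction needs: two surpluses add up to the 2 that pays
  for both terminals in \<open>heavy_piece_reducible\<close>, while a series composition spends one of them on the
  vertex \<open>x\<close> that it leaves out. The freedom to choose \<open>t\<close> is used in the series case: a set
  compatible with \<open>x\<close> absorbs \<open>x\<close> when the other side is empty, and otherwise the side of \<open>t\<close>
  supplies the compatibility with \<open>t\<close>.
\<close>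

lemma irreducible_piece:
  assumes irr: "\<not> reducible E V" and K: "no_K4_model E V" and fin: "finite V" and V: "conn_set E V"
    and "piece E V u w H" "H \<noteq> {}" "t = u \<or> t = w"
  shows "\<exists>I \<subseteq> H. dissociated E (insert t I) \<and> card H + 1 \<le> 2 * card I"
  using assms(5-)
proof (induction "card H" arbitrary: u w H t rule: less_induct)
  case less
  note P = less.prems(1)
  have finH: "finite H" using pieceD(1)[OF P] fin by (rule finite_subset)
  from K fin V P less.prems(2) show ?case
  proof (cases rule: piece_decomposition)
    case (parallel H1 H2)
    have fin12: "finite H1" "finite H2" using parallel(4) finH by auto
    have cH: "card H = card H1 + card H2"
      using parallel(3,4) fin12 by (simp add: card_Un_disjoint)
    have "card H1 < card H" "card H2 < card H" using cH fin12 parallel(1,2) by (auto simp: card_gt_0_iff)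
    then obtain I1 I2 where
      I1: "I1 \<subseteq> H1" "dissociated E (insert u I1)" "card H1 + 1 \<le> 2 * card I1" and
      I2: "I2 \<subseteq> H2" "dissociated E (insert u I2)" "card H2 + 1 \<le> 2 * card I2"
      using less.hyps[OF _ parallel(5,1), of u] less.hyps[OF _ parallel(6,2), of u] by blast
    have "(a, b) \<notin> E" if "a \<in> I1" "b \<in> I2" for a b
      using pieceD(7)[OF parallel(5), of a b] pieceD(1-3)[OF parallel(6)] that I1(1) I2(1) parallel(3) by blast
    then have "dissociated E (I1 \<union> I2)"
      using dissociated_mono[OF I1(2)] dissociated_mono[OF I2(2)] by (intro dissociated_Un) blast+
    moreover have "card (I1 \<union> I2) = card I1 + card I2"
      using I1(1) I2(1) fin12 parallel(3) by (intro card_Un_disjoint) (auto intro: finite_subset)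
    then have "card H + 2 \<le> 2 * card (I1 \<union> I2)" using I1(3) I2(3) cH by linarith
    moreover have "I1 \<union> I2 \<subseteq> H" using I1(1) I2(1) parallel(4) by blast
    ultimately have "reducible E V" using heavy_piece_reducible[OF P fin] by blast
    with irr show ?thesis by blast
  next
    case (series x H1 H2)
    have fin12: "finite H1" "finite H2" using series(4) finH by auto
    have cH: "card H = card H1 + card H2 + 1"
      using series(1-4) fin12 by (simp add: card_Un_disjoint)
    have IH1: "\<exists>I \<subseteq> H1. dissociated E (insert s I) \<and> card H1 + 1 \<le> 2 * card I"
      if "H1 \<noteq> {}" "s = u \<or> s = x" for s
      by (rule less.hyps[OF _ series(5) that]) (use cH in simp)
    have IH2: "\<exists>I \<subseteq> H2. dissociated E (insert s I) \<and> card H2 + 1 \<le> 2 * card I"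
      if "H2 \<noteq> {}" "s = x \<or> s = w" for s
      by (rule less.hyps[OF _ series(6) that]) (use cH in simp)
    \<comment> \<open>The case of exactly one empty side: \<open>H'\<close> is the other side, and \<open>x\<close> joins its set.\<close>
    have heavy: False if "I \<subseteq> H'" "dissociated E (insert x I)" "card H' + 1 \<le> 2 * card I"
      "H = insert x H'" "x \<notin> H'" for I H'
    proof -
      have "finite H'" "finite I" using that finH by (auto intro: finite_subset)
      then have "card H + 2 \<le> 2 * card (insert x I)" using that by (auto simp: card_insert_if)
      moreover have "insert x I \<subseteq> H" using that by blast
      ultimately show False using heavy_piece_reducible[OF P fin] that(2) irr by blast
    qed
    have ne: "u \<noteq> w" using pieceD(4)[OF P] .
    note p1 = pieceD[OF series(5)] and p2 = pieceD[OF series(6)]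
    have w1: "w \<notin> H1" and u2: "u \<notin> H2" using pieceD(2,3)[OF P] series(4) by auto
    consider "H1 = {}" "H2 = {}" | "H1 \<noteq> {}" "H2 = {}" | "H1 = {}" "H2 \<noteq> {}" | "H1 \<noteq> {}" "H2 \<noteq> {}"
      by blast
    then show ?thesis
    proof cases
      case 1
      then show ?thesis
        using series(4) dissociated_pair[of t x] by (intro exI[of _ "{x}"]) auto
    next
      case 2
      then show ?thesis using IH1[of x] heavy[of _ H1] series by auto
    next
      case 3
      then show ?thesis using IH2[of x] heavy[of _ H2] series by auto
    next
      case 4
      obtain I1 where I1: "I1 \<subseteq> H1" "dissociated E (insert u I1)" "card H1 + 1 \<le> 2 * card I1"
        using IH1[OF 4(1), of u] by blast
      obtain I2 where I2: "I2 \<subseteq> H2" "dissociated E (insert w I2)" "card H2 + 1 \<le> 2 * card I2"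
        using IH2[OF 4(2), of w] by blast
      have d: "dissociated E I1" "dissociated E I2"
        by (rule dissociated_mono, rule I1 I2, blast)+
      have no_edge: "(a, b) \<notin> E" if "a \<in> insert u I1" "b \<in> I2" for a b
      proof
        assume ab: "(a, b) \<in> E"
        have b: "b \<in> H2" "b \<in> V" "b \<notin> H1" using that(2) I2(1) p2(1) series(3) by blast+
        show False
        proof (cases "a = u")
          case True
          then show False using p2(7)[OF b(1) edge_sym[OF ab]] p1(4,5) u2 ne by blast
        next
          case False
          then have "a \<in> H1" using that(1) I1(1) by blast
          then show False using p1(7)[OF _ ab b(2)] b(1,3) u2 p2(2) by blast
        qed
      qed
      have "(a, w) \<notin> E" if "a \<in> I1" for a
        using p1(7)[of a w] that I1(1) w1 ne p2(4,6) by blast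
      with no_edge have no_edge': "(a, b) \<notin> E" if "a \<in> I1" "b \<in> insert w I2" for a b
        using that by blast
      have "dissociated E (insert t (I1 \<union> I2))"
      proof (cases "t = u")
        case True
        then have "dissociated E (insert u I1 \<union> I2)" using I1(2) d(2) no_edge by (intro dissociated_Un) auto
        then show ?thesis using True by simp
      next
        case False
        then have t: "t = w" using less.prems(3) by blast
        then have "dissociated E (I1 \<union> insert w I2)" using I2(2) d(1) no_edge' by (intro dissociated_Un) auto
        then show ?thesis using t by simp
      qed
      moreover have "card (I1 \<union> I2) = card I1 + card I2"
        using I1(1) I2(1) fin12 series(3) by (intro card_Un_disjoint) (auto intro: finite_subset)
      then have "card H + 1 \<le> 2 * card (I1 \<union> I2)" using I1(3) I2(3) cH by linarith
      moreover have "I1 \<union> I2 \<subseteq> H" using I1(1) I2(1) series(4) by blast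
      ultimately show ?thesis by blast
    qed
  qed
qed

text \<open>With at most one neighbour, \<open>{v}\<close> itself could be split off.\<close>

lemma irreducible_has_two_neighbours:
  assumes "\<not> reducible E V" "v \<in> V"
  shows "card (E `` {v} \<inter> V) \<ge> 2"
proof -
  have "dissociated E {v}" using dissociated_pair[of v v] by simp
  then have "card (E `` {v} \<inter> V - {v}) > card {v}"
    using assms unfolding reducible_def by (metis empty_not_insert insert_subset not_le empty_subsetI)
  moreover have "E `` {v} \<inter> V - {v} = E `` {v} \<inter> V" using edge_neq by blast
  ultimately show ?thesis by simp
qed

lemma no_K4_model_mono: "no_K4_model E V \<Longrightarrow> V' \<subseteq> V \<Longrightarrow> no_K4_model E V'"
  unfolding no_K4_model_def by blast

text \<open>
  The induction hypothesis has two uses: it solves what remains of a reducible graph, and it shows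
  that an irreducible graph is connected. After that, the irreducible graph consists of the ends of an
  edge and one piece between them, and \<open>irreducible_piece\<close> gives the set directly.
\<close>

theorem half_dissociated:
  assumes "finite V" "no_K4_model E V"
  shows "\<exists>S \<subseteq> V. dissociated E S \<and> card V \<le> 2 * card S"
  using assms
proof (induction "card V" arbitrary: V rule: less_induct)
  case less
  note fin = less.prems(1) and K = less.prems(2)
  consider (empty) "V = {}" | (reducible) "reducible E V" | (irreducible) "V \<noteq> {}" "\<not> reducible E V" by blast
  then show ?case
  proof cases
    case empty
    then show ?thesis by (auto simp: dissociated_def)
  next
    case reducible
    then obtain I where I: "I \<subseteq> V" "I \<noteq> {}" "dissociated E I" "card (E `` I \<inter> V - I) \<le> card I"
      unfolding reducible_def by blast
    define N where "N = E `` I \<inter> V - I"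
    define V' where "V' = V - (I \<union> N)"
    have finI: "finite I" "finite N" unfolding N_def using I(1) fin by (auto intro: finite_subset)
    have V'V: "V' \<subseteq> V" unfolding V'_def by blast
    have "card V' = card V - card (I \<union> N)"
      unfolding V'_def by (rule card_Diff_subset) (use I(1) finI N_def in auto)
    moreover have "card (I \<union> N) \<le> 2 * card I" using I(4) card_Un_le[of I N] unfolding N_def by linarith
    ultimately have cV: "card V \<le> card V' + 2 * card I" by linarith
    have "card V' < card V" unfolding V'_def by (rule psubset_card_mono) (use fin I in auto)
    then obtain S where S: "S \<subseteq> V'" "dissociated E S" "card V' \<le> 2 * card S"
      using less.hyps[of V'] no_K4_model_mono[OF K V'V] finite_subset[OF V'V fin] by blast
    have "dissociated E (I \<union> S)"
      using I(3) S(2) by (rule dissociated_Un) (use S(1) in \<open>auto simp: V'_def N_def\<close>)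
    moreover have "card (I \<union> S) = card I + card S"
      using S(1) finI finite_subset[OF V'V fin]
      by (intro card_Un_disjoint) (auto simp: V'_def intro: finite_subset)
    then have "card V \<le> 2 * card (I \<union> S)" using cV S(3) by linarith
    ultimately show ?thesis using I(1) S(1) V'V by blast
  next
    case irreducible
    note irr = irreducible(2)
    \<comment> \<open>A proper union \<open>X\<close> of components has a large dissociated set by induction; its neighbours all
      lie in \<open>X\<close>, and so it could be split off.\<close>
    have V: "conn_set E V"
    proof (rule ccontr)
      assume n: "\<not> conn_set E V"
      from irreducible(1) obtain v where "v \<in> V" by blast
      with n obtain X where X: "X \<subseteq> V" "X \<noteq> {}" "v \<notin> X" "\<not> touches E X (V - X)" by (rule not_conn_setE)
      have "card X < card V" using fin X \<open>v \<in> V\<close> by (intro psubset_card_mono) auto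
      moreover have finX: "finite X" using X(1) fin by (rule finite_subset)
      ultimately obtain S where S: "S \<subseteq> X" "dissociated E S" "card X \<le> 2 * card S"
        using less.hyps[of X] no_K4_model_mono[OF K X(1)] by blast
      have "E `` S \<inter> V - S \<subseteq> X - S" using X(4) S(1) unfolding touches_def by blast
      then have "card (E `` S \<inter> V - S) \<le> card (X - S)" using finX by (intro card_mono) auto
      also have "\<dots> = card X - card S" using S(1) finX by (intro card_Diff_subset) (auto intro: finite_subset)
      finally have "card (E `` S \<inter> V - S) \<le> card S" using S(3) by linarith
      moreover have "S \<noteq> {}" using S(3) X(2) finX by (auto simp: card_gt_0_iff)
      ultimately show False using irr S X(1) unfolding reducible_def by blast
    qed
    from irreducible(1) obtain u where u: "u \<in> V" by blast
    then have two: "card (E `` {u} \<inter> V) \<ge> 2" by (rule irreducible_has_two_neighbours[OF irr])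
    then obtain w where w: "w \<in> V" "(u, w) \<in> E"
      by (metis (no_types, lifting) IntE Image_singleton_iff card.empty ex_in_conv not_numeral_le_zero)
    \<comment> \<open>The edge from \<open>u\<close> to \<open>w\<close> is their connection outside \<open>H\<close>.\<close>
    define H where "H = V - {u, w}"
    have uw: "u \<noteq> w" using edge_neq w by blast
    have P: "piece E V u w H"
      by (rule pieceI) (use u w uw in \<open>auto simp: H_def intro: walk_edge\<close>)
    have "H \<noteq> {}"
    proof
      assume "H = {}"
      then have "E `` {u} \<inter> V \<subseteq> {w}" using edge_neq unfolding H_def by blast
      then have "card (E `` {u} \<inter> V) \<le> 1" using card_mono[of "{w}"] by fastforce
      with two show False by linarith
    qed
    then obtain I where I: "I \<subseteq> H" "dissociated E (insert u I)" "card H + 1 \<le> 2 * card I"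
      using irreducible_piece[OF irr K fin V P, of u] by blast
    have "finite I" using I(1) fin unfolding H_def by (auto intro: finite_subset)
    then have "card (insert u I) = card I + 1" using I(1) unfolding H_def by (auto simp: card_insert_if)
    moreover have "card V = card H + 2"
    proof -
      have "V = insert u (insert w H)" using u w unfolding H_def by blast
      then show ?thesis using uw fin unfolding H_def
        by (metis P H_def pieceD(2,3) card_insert_disjoint finite_Diff finite_insert insert_iff add_2_eq_Suc')
    qed
    moreover have "insert u I \<subseteq> V" using u I(1) unfolding H_def by blast
    ultimately show ?thesis using I(2,3) by (intro exI[of _ "insert u I"]) auto
  qed
qed

end


section \<open>Indeque sets of \<open>K\<^sub>4\<close>-minor-free graphs\<close>

lemma rtrancl_on_restrict: "rtrancl_on A (E \<inter> A \<times> A) = rtrancl_on A E"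
proof (intro equalityI subrelI)
  fix a b assume "(a, b) \<in> rtrancl_on A E"
  then show "(a, b) \<in> rtrancl_on A (E \<inter> A \<times> A)"
    by (induction rule: rtrancl_on_induct) (auto intro: rtrancl_on_into_rtrancl_on)
next
  fix a b assume "(a, b) \<in> rtrancl_on A (E \<inter> A \<times> A)"
  then show "(a, b) \<in> rtrancl_on A E" by (rule rtrancl_on_mono[rotated 2]) auto
qed

context pair_graph
begin

lemma edge_relation: "edge_relation (parcs G)"
  using sym_arcs no_loops' by unfold_locales (auto simp: symmetric_def irrefl_def)

lemma conn_set_if_connected_subgraph:
  assumes "subgraph C (with_proj G)" and con: "Digraph_Component.connected C"
  shows "conn_set (parcs G) (verts C)"
proof -
  have "arcs_ends C \<subseteq> parcs G" using arcs_ends_mono[OF assms(1)] by simp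
  then have sub: "(arcs_ends C)\<^sup>s \<subseteq> parcs G"
    using arcs_symmetric by (auto simp: symcl_def)
  have "(a, b) \<in> rtrancl_on (verts C) (parcs G)" if "a \<in> verts C" "b \<in> verts C" for a b
    by (rule rtrancl_on_mono[OF sub subset_refl]) (use con that in \<open>simp add: connected_conv\<close>)
  then show "conn_set (parcs G) (verts C)"
    using con by (simp add: connected_conv conn_set_def)
qed

lemma connected_induced_iff:
  "Digraph_Component.connected (with_proj G \<restriction> A) \<longleftrightarrow> conn_set (parcs G) A"
proof -
  have "(arcs_ends (with_proj G \<restriction> A))\<^sup>s = parcs G \<inter> A \<times> A"
    using arcs_symmetric by (force simp: symcl_def arcs_ends_conv)
  then show ?thesis
    by (simp add: connected_conv conn_set_def rtrancl_on_restrict)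
qed

lemma no_K4_model_if_K4_minor_free:
  assumes "K4_minor_free (with_proj G)"
  shows "no_K4_model (parcs G) (pverts G)"
  unfolding no_K4_model_def
proof
  assume "\<exists>A B C D. A \<union> B \<union> C \<union> D \<subseteq> pverts G \<and> K4_model (parcs G) A B C D"
  then obtain A B C D where sub: "A \<union> B \<union> C \<union> D \<subseteq> pverts G" and M: "K4_model (parcs G) A B C D"
    by blast
  interpret edge_relation "parcs G" by (rule edge_relation)
  define H :: "nat pair_pre_digraph" where
    "H = \<lparr>pverts = {..<4}, parcs = {(u, v). (u, v) \<in> {..<4} \<times> {..<4} \<and> u \<noteq> v}\<rparr>"
  define branch where "branch i = [A, B, C, D] ! i" for i
  have four: "{..<4::nat} = {0, 1, 2, 3}" by auto
  have b: "branch 0 = A" "branch (Suc 0) = B" "branch 1 = B" "branch 2 = C" "branch 3 = D"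
    by (simp_all add: branch_def)
  have "K\<^bsub>4\<^esub> (with_proj H)" unfolding complete_digraph_pair_def by (simp add: H_def)
  moreover have "minor (with_proj H) (with_proj G)"
    unfolding minor_def
  proof (intro exI[of _ branch] conjI ballI allI impI)
    fix x assume "x \<in> verts (with_proj H)"
    then have x: "x \<in> {0, 1, 2, 3}" by (simp add: H_def four)
    then show bG: "branch x \<subseteq> verts (with_proj G)" using sub by (auto simp: b)
    show "Digraph_Component.connected (with_proj G \<restriction> branch x)"
      using x M unfolding connected_induced_iff by (auto simp: b K4_model_def)
  next
    show "disjoint_family_on branch (verts (with_proj H))"
      using M unfolding disjoint_family_on_def H_def K4_model_def by (simp add: four b) blast
  next
    fix x y assume "x \<rightarrow>\<^bsub>with_proj H\<^esub> y"
    then have xy: "x \<in> {0, 1, 2, 3}" "y \<in> {0, 1, 2, 3}" "x \<noteq> y" by (auto simp: H_def simp flip: four)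
    have "touches (parcs G) (branch x) (branch y)"
      using xy M touches_sym[of A B] touches_sym[of A C] touches_sym[of A D]
        touches_sym[of B C] touches_sym[of B D] touches_sym[of C D]
      unfolding K4_model_def by (auto simp: b)
    then show "\<exists>u \<in> branch x. \<exists>v \<in> branch y. u \<rightarrow>\<^bsub>with_proj G\<^esub> v" by (simp add: touches_def)
  qed
  ultimately show False using assms unfolding K4_minor_free_def by blast
qed

lemma induced_subgraph_subset: "S \<subseteq> pverts G \<Longrightarrow> induced_subgraph (with_proj G \<restriction> S) (with_proj G)"
  using induced_induce by simp

text \<open>
  A component is a maximal connected subgraph with arcs of its own choice; it is induced because
  adding arcs preserves connectedness.
\<close>

lemma component_induced:
  assumes "S \<subseteq> pverts G" "is_component (with_proj G \<restriction> S) C"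
  shows "induced_subgraph C (with_proj G)" "verts C \<subseteq> S" "conn_set (parcs G) (verts C)"
proof -
  have m: "pre_digraph.max_subgraph (with_proj G \<restriction> S) Digraph_Component.connected C"
    using assms(2) by (simp add: is_component_def)
  have "arc_mono Digraph_Component.connected"
    unfolding arc_mono_def
    by (metis spanning_def subgraphE wf_digraph.connected_spanning_imp_connected)
  then have C: "induced_subgraph C (with_proj G \<restriction> S)"
    using m pre_digraph.induced_subgraphI_arc_mono by blast
  have S: "induced_subgraph (with_proj G \<restriction> S) (with_proj G)"
    using assms(1) by (rule induced_subgraph_subset)
  have sub: "subgraph C (with_proj G)"
    using C S by (metis induced_imp_subgraph subgraph_trans)
  show vC: "verts C \<subseteq> S" using subgraph_imp_subverts[OF induced_imp_subgraph[OF C]] by simp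
  have "tail C = fst" "head C = snd" using sub by (auto simp: subgraph_def compatible_def)
  then show "induced_subgraph C (with_proj G)"
    using C vC by (intro induced_subgraphI sub) (auto elim!: induced_subgraphE)
  show "conn_set (parcs G) (verts C)"
    using conn_set_if_connected_subgraph[OF sub] m by (auto simp: pre_digraph.max_subgraph_def)
qed

lemma arcs_ends_induced:
  assumes "induced_subgraph C (with_proj G)"
  shows "arcs_ends C = parcs G \<inter> verts C \<times> verts C"
proof -
  have "tail C = fst" "head C = snd" using assms by (auto simp: induced_subgraph_def subgraph_def compatible_def)
  then show ?thesis using assms by (force simp: arcs_ends_conv induced_subgraph_def)
qed

text \<open>
  A walk in a dissociated set can only go back and forth along one edge, so a component has no two
  distinct nonadjacent vertices.
\<close>

lemma indeque_if_dissociated: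
  assumes "S \<subseteq> pverts G" "dissociated (parcs G) S"
  shows "indeque_set G S"
  unfolding indeque_set_def
proof (intro conjI allI impI)
  fix C assume comp: "is_component (with_proj G \<restriction> S) C"
  note C = component_induced[OF assms(1) comp]
  have adj: "u = v \<or> (u, v) \<in> parcs G" if "(u, v) \<in> rtrancl_on (verts C) (parcs G)" for u v
    using that
  proof (induction rule: rtrancl_on_induct)
    case (step y z)
    have "u \<in> verts C" using step(1) by (rule in_rtrancl_on_in_F)
    then have "z = u" if "(u, y) \<in> parcs G"
      using assms(2) arcs_symmetric[OF that] step(2-4) C(2) unfolding dissociated_def by blast
    then show ?case using step by blast
  qed simp
  have complete: "u = v \<or> (u, v) \<in> parcs G" if "u \<in> verts C" "v \<in> verts C" for u v
    using adj C(3) that by (simp add: conn_set_def)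
  have "arcs_ends C = {(u, v). (u, v) \<in> verts C \<times> verts C \<and> u \<noteq> v}"
    unfolding arcs_ends_induced[OF C(1)] using no_loops' complete by blast
  moreover have "graph C"
    using C(1) by (intro digraph.graphI digraphI_induced) (auto intro: induced_graph_imp_symmetric)
  ultimately show "is_clique C" unfolding is_clique_def complete_digraph_def by blast
qed (rule assms)

text \<open>
  An indeque set induces no path on three vertices: all three would lie in the component of the
  middle one, which is a clique.
\<close>

lemma indeque_set_transitive:
  assumes S: "indeque_set G S" and "a \<in> S" "b \<in> S" "c \<in> S"
    and ab: "(a, b) \<in> parcs G" and bc: "(b, c) \<in> parcs G" and "a \<noteq> c"
  shows "(a, c) \<in> parcs G"
proof -
  interpret E: edge_relation "parcs G" by (rule edge_relation)
  have SG: "S \<subseteq> pverts G" using S by (simp add: indeque_set_def)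
  define A where "A = comp_of (parcs G) S b"
  have A: "A \<subseteq> S" "conn_set (parcs G) A" unfolding A_def
    using E.comp_of_subset E.conn_set_comp_of[OF \<open>b \<in> S\<close>] by auto
  have b: "b \<in> A" unfolding A_def by (rule E.comp_of_self) fact
  have abc: "a \<in> A" "c \<in> A"
    using E.comp_of_closed[OF b[unfolded A_def]] E.edge_sym[OF ab] bc assms(2,4) unfolding A_def by auto
  define C where "C = with_proj G \<restriction> A"
  have "is_component (with_proj G \<restriction> S) C"
    unfolding is_component_def
  proof (rule pre_digraph.max_subgraphI)
    show "Digraph_Component.connected C" unfolding C_def
      using A(2) by (simp add: connected_induced_iff)
    show "subgraph C (with_proj G \<restriction> S)"
      unfolding C_def using A(1) by (intro subgraphI) (auto simp: compatible_def intro: wellformed_induce_subgraph)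
    fix C' assume C': "C \<noteq> C'" "subgraph C C'" "subgraph C' (with_proj G \<restriction> S)"
    have sub: "subgraph C' (with_proj G)"
      using C'(3) induced_imp_subgraph[OF induced_subgraph_subset[OF SG]] by (rule subgraph_trans)
    show "\<not> Digraph_Component.connected C'"
    proof
      assume "Digraph_Component.connected C'"
      then have "conn_set (parcs G) (verts C')" by (rule conn_set_if_connected_subgraph[OF sub])
      moreover have "verts C' \<subseteq> S" "b \<in> verts C'" using C' b by (auto simp: subgraph_def C_def)
      ultimately have "verts C' \<subseteq> A" unfolding A_def by (rule E.conn_set_subset_comp_of)
      then have "verts C' = verts C" using C' by (auto simp: subgraph_def C_def)
      moreover have td: "tail C' = tail C" "head C' = head C" using C' by (auto simp: subgraph_def compatible_def)
      moreover have "arcs C' \<subseteq> arcs C"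
        using sub calculation by (auto simp: subgraph_def C_def dest: wf_digraph.wellformed)
      then have "arcs C' = arcs C" using C'(2) by (auto simp: subgraph_def)
      ultimately have "C = C'" by simp
      with C'(1) show False by blast
    qed
  qed
  then have "is_clique C" using S by (simp add: indeque_set_def)
  then have "(a, c) \<in> arcs_ends C"
    using abc \<open>a \<noteq> c\<close> unfolding is_clique_def complete_digraph_def by (auto simp: C_def)
  then show ?thesis by (auto simp: C_def arcs_ends_conv)
qed

lemma finite_indeque_sizes: "finite {card S | S. indeque_set G S}"
proof -
  have "{card S | S. indeque_set G S} \<subseteq> card ` Pow (pverts G)" by (auto simp: indeque_set_def)
  then show ?thesis using pair_finite_verts by (meson finite_Pow_iff finite_imageI finite_subset)
qed

lemma indeque_numberI: "indeque_set G S \<Longrightarrow> card S \<le> indeque_number G"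
  unfolding indeque_number_def using finite_indeque_sizes by (intro Max_ge) auto

lemma indeque_number_witness: "\<exists>S. indeque_set G S \<and> card S = indeque_number G"
proof -
  have "indeque_set G {}" by (rule indeque_if_dissociated) (auto simp: dissociated_def)
  then have "{card S | S. indeque_set G S} \<noteq> {}" by blast
  then have "indeque_number G \<in> {card S | S. indeque_set G S}"
    unfolding indeque_number_def by (rule Max_in[OF finite_indeque_sizes])
  then show ?thesis by auto
qed

theorem indeque_number_ge_half:
  assumes "K4_minor_free (with_proj G)"
  shows "card (pverts G) \<le> 2 * indeque_number G"
proof -
  interpret E: edge_relation "parcs G" by (rule edge_relation)
  obtain S where "S \<subseteq> pverts G" "dissociated (parcs G) S" "card (pverts G) \<le> 2 * card S"
    using E.half_dissociated[OF pair_finite_verts no_K4_model_if_K4_minor_free[OF assms]] by blast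
  then show ?thesis using indeque_if_dissociated[of S] indeque_numberI[of S] by fastforce
qed

end


section \<open>Disjoint 4-cycles\<close>

text \<open>
  The block \<open>4k, 4k + 1, 4k + 2, 4k + 3\<close> is a 4-cycle: inside it, numbers of different parity are
  adjacent. If 4 does not divide \<open>n\<close>, the last block is cut off, which costs only a bounded error.
\<close>

definition disjoint_4_cycles :: "nat \<Rightarrow> nat pair_pre_digraph" where
  "disjoint_4_cycles n = \<lparr>pverts = {..<n},
     parcs = {(i, j). i < n \<and> j < n \<and> i div 4 = j div 4 \<and> odd (i + j)}\<rparr>"

lemma pair_graph_disjoint_4_cycles: "pair_graph (disjoint_4_cycles n)"
proof -
  have "parcs (disjoint_4_cycles n) \<subseteq> {..<n} \<times> {..<n}" by (auto simp: disjoint_4_cycles_def)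
  then have fin: "finite (parcs (disjoint_4_cycles n))" by (rule finite_subset) auto
  show ?thesis
    by unfold_locales (use fin in \<open>auto simp: disjoint_4_cycles_def symmetric_def intro!: symI\<close>)
qed

lemma div_4_cases: "i div 4 = k \<Longrightarrow> i \<in> {4 * k, 4 * k + 1, 4 * k + 2, 4 * k + (3::nat)}"
  by auto

text \<open>
  The branch sets of a \<open>K\<^sub>4\<close> minor are connected and pairwise adjacent, so all lie in one block. Four
  disjoint nonempty sets in a block of four vertices are singletons, but the block contains
  nonadjacent vertices.
\<close>

lemma K4_minor_free_disjoint_4_cycles: "K4_minor_free (with_proj (disjoint_4_cycles n))"
  unfolding K4_minor_free_def
proof
  let ?G = "disjoint_4_cycles n"
  interpret pair_graph ?G by (rule pair_graph_disjoint_4_cycles)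
  assume "\<exists>H :: nat pair_pre_digraph. K\<^bsub>4\<^esub> (with_proj H) \<and> minor (with_proj H) (with_proj ?G)"
  then obtain H :: "nat pair_pre_digraph" where
    "K\<^bsub>4\<^esub> (with_proj H)" and minor: "minor (with_proj H) (with_proj ?G)" by blast
  then have H: "finite (pverts H)" "card (pverts H) = 4"
      "parcs H = {(u, v). (u, v) \<in> pverts H \<times> pverts H \<and> u \<noteq> v}"
    by (simp_all add: complete_digraph_pair_def)
  from minor obtain B where
    "\<forall>x \<in> pverts H. B x \<subseteq> pverts ?G \<and> Digraph_Component.connected (with_proj ?G \<restriction> B x)"
    and disjoint: "disjoint_family_on B (pverts H)"
    and adjacent: "\<forall>x y. (x, y) \<in> parcs H \<longrightarrow> (\<exists>u \<in> B x. \<exists>v \<in> B y. (u, v) \<in> parcs ?G)"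
    unfolding minor_def with_proj_simps by blast
  then have conn: "conn_set (parcs ?G) (B x)" if "x \<in> pverts H" for x
    using connected_induced_iff that by blast
  have edge: "i div 4 = j div 4" if "(i, j) \<in> parcs ?G" for i j
    using that by (simp add: disjoint_4_cycles_def)
  have walk: "i div 4 = j div 4" if "(i, j) \<in> rtrancl_on A (parcs ?G)" for i j A
    using that by (induction rule: rtrancl_on_induct) (auto dest: edge)
  obtain x0 where x0: "x0 \<in> pverts H" using H(2) by fastforce
  then obtain i0 where i0: "i0 \<in> B x0" using conn unfolding conn_set_def by blast
  define k where "k = i0 div 4"
  have block: "i div 4 = k" if x: "x \<in> pverts H" and i: "i \<in> B x" for x i
  proof (cases "x = x0")
    case True
    then show ?thesis using walk conn[OF x0] i i0 unfolding k_def conn_set_def by blast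
  next
    case False
    then obtain u v where uv: "u \<in> B x0" "v \<in> B x" "(u, v) \<in> parcs ?G"
      using adjacent x x0 H(3) by blast
    have "i div 4 = v div 4" using walk conn[OF x] i uv unfolding conn_set_def by blast
    also have "\<dots> = u div 4" using edge[OF uv(3)] by simp
    also have "\<dots> = k" using walk conn[OF x0] i0 uv unfolding k_def conn_set_def by blast
    finally show ?thesis .
  qed
  define b where "b x = (SOME i. i \<in> B x)" for x
  have b: "b x \<in> B x" if "x \<in> pverts H" for x
    unfolding b_def using conn[OF that] by (simp add: some_in_eq conn_set_def)
  have same: "x = y" if "x \<in> pverts H" "y \<in> pverts H" "i \<in> B x" "i \<in> B y" for x y i
    using disjoint that unfolding disjoint_family_on_def by blast
  have inj: "inj_on b (pverts H)" using same b by (metis inj_onI)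
  define Q where "Q = {4 * k, 4 * k + 1, 4 * k + 2, 4 * k + 3}"
  have "b ` pverts H = Q"
  proof (rule card_subset_eq)
    show "finite Q" "b ` pverts H \<subseteq> Q" unfolding Q_def using block b div_4_cases by blast+
    show "card (b ` pverts H) = card Q" using H(2) card_image[OF inj] by (simp add: Q_def)
  qed
  then have single: "B x = {b x}" if x: "x \<in> pverts H" for x
  proof -
    have "i = b x" if "i \<in> B x" for i
    proof -
      have "i \<in> Q" unfolding Q_def using div_4_cases block[OF x that] by blast
      then obtain y where y: "y \<in> pverts H" "i = b y" using \<open>b ` pverts H = Q\<close> by blast
      then show ?thesis using same[OF x y(1) that] b[OF y(1)] by blast
    qed
    then show ?thesis using b[OF x] by blast
  qed
  have "4 * k \<in> b ` pverts H" "4 * k + 2 \<in> b ` pverts H" using \<open>b ` pverts H = Q\<close> Q_def by auto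
  then obtain x y where xy: "x \<in> pverts H" "y \<in> pverts H" "b x = 4 * k" "b y = 4 * k + 2"
    by (metis imageE)
  then have "(x, y) \<in> parcs H" using H(3) by auto
  then obtain u v where "u \<in> B x" "v \<in> B y" "(u, v) \<in> parcs ?G" using adjacent by blast
  then have "(4 * k, 4 * k + 2) \<in> parcs ?G" using single xy by simp
  then show False by (simp add: disjoint_4_cycles_def)
qed

text \<open>
  Any three vertices of a 4-cycle form a path, so a complete block contributes at most two vertices.
  The incomplete block contributes at most three vertices, which exceeds half of its size by at most 3/2.
\<close>

lemma indeque_number_disjoint_4_cycles: "2 * indeque_number (disjoint_4_cycles n) \<le> n + 3"
proof -
  let ?G = "disjoint_4_cycles n"
  interpret pair_graph ?G by (rule pair_graph_disjoint_4_cycles)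
  obtain S where S: "indeque_set ?G S" "card S = indeque_number ?G" using indeque_number_witness by blast
  have Sn: "S \<subseteq> {..<n}" using S(1) by (simp add: indeque_set_def disjoint_4_cycles_def)
  have path: False if "a \<in> S" "b \<in> S" "c \<in> S" "a div 4 = b div 4" "b div 4 = c div 4"
    "odd (a + b)" "odd (b + c)" "a \<noteq> c" for a b c
  proof -
    have "(a, c) \<in> parcs ?G"
      using indeque_set_transitive[OF S(1) that(1-3) _ _ that(8)] that Sn
      by (auto simp: disjoint_4_cycles_def)
    then show False using that by (simp add: disjoint_4_cycles_def)
  qed
  have offsets: False if "4 * k + i \<in> S" "4 * k + j \<in> S" "4 * k + l \<in> S" "i < 4" "j < 4" "l < 4"
    "odd (i + j)" "odd (j + l)" "i \<noteq> l" for k i j l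
    by (rule path[OF that(1-3)]) (use that in auto)
  have block: "card (S \<inter> {4 * k..<4 * k + 4}) \<le> 2" for k
  proof -
    have "{4 * k..<4 * k + 4} = {4 * k, 4 * k + 1, 4 * k + 2, 4 * k + 3}" by auto
    moreover have "\<not> (4 * k \<in> S \<and> 4 * k + 1 \<in> S \<and> 4 * k + 2 \<in> S)"
      using offsets[of k 0 1 2] by auto
    moreover have "\<not> (4 * k \<in> S \<and> 4 * k + 3 \<in> S \<and> 4 * k + 2 \<in> S)"
      using offsets[of k 0 3 2] by auto
    moreover have "\<not> (4 * k + 1 \<in> S \<and> 4 * k \<in> S \<and> 4 * k + 3 \<in> S)"
      using offsets[of k 1 0 3] by auto
    moreover have "\<not> (4 * k + 1 \<in> S \<and> 4 * k + 2 \<in> S \<and> 4 * k + 3 \<in> S)"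
      using offsets[of k 1 2 3] by auto
    ultimately show ?thesis
      by (cases "4 * k \<in> S"; cases "4 * k + 1 \<in> S"; cases "4 * k + 2 \<in> S"; cases "4 * k + 3 \<in> S") simp_all
  qed
  have blocks: "card (S \<inter> {..<4 * m}) \<le> 2 * m" for m
  proof (induction m)
    case (Suc m)
    have "S \<inter> {..<4 * Suc m} = (S \<inter> {..<4 * m}) \<union> (S \<inter> {4 * m..<4 * m + 4})" by auto
    then show ?case using Suc block[of m] card_Un_le[of "S \<inter> {..<4 * m}" "S \<inter> {4 * m..<4 * m + 4}"] by simp
  qed simp
  have "S = (S \<inter> {..<4 * (n div 4)}) \<union> (S \<inter> {4 * (n div 4)..<n})" using Sn by auto
  then have "card S \<le> card (S \<inter> {..<4 * (n div 4)}) + card (S \<inter> {4 * (n div 4)..<n})"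
    by (metis card_Un_le)
  moreover have "card (S \<inter> {4 * (n div 4)..<n}) \<le> card {4 * (n div 4)..<n}" by (intro card_mono) auto
  ultimately show ?thesis using blocks[of "n div 4"] S(2) by simp
qed


section \<open>The limit\<close>

lemma class_indeque_number_bounds:
  "n \<le> 2 * class_indeque_number K4_minor_free_graphs n"
  "2 * class_indeque_number K4_minor_free_graphs n \<le> n + 3"
proof -
  let ?X = "{indeque_number G | G. G \<in> K4_minor_free_graphs \<and> card (pverts G) = n}"
  have upper: "indeque_number G \<le> n" if "pair_graph G" "card (pverts G) = n" for G :: "nat pair_pre_digraph"
  proof -
    interpret pair_graph G by fact
    obtain S where "indeque_set G S" "card S = indeque_number G" using indeque_number_witness by blast
    then show ?thesis using card_mono[OF pair_finite_verts, of S] that(2) by (simp add: indeque_set_def)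
  qed
  then have "?X \<subseteq> {..n}" by (auto simp: K4_minor_free_graphs_def)
  then have fin: "finite ?X" by (rule finite_subset) simp
  have mem: "indeque_number (disjoint_4_cycles n) \<in> ?X"
    using pair_graph_disjoint_4_cycles K4_minor_free_disjoint_4_cycles
    by (auto simp: K4_minor_free_graphs_def disjoint_4_cycles_def intro!: exI[of _ "disjoint_4_cycles n"])
  have "class_indeque_number K4_minor_free_graphs n \<in> ?X"
    unfolding class_indeque_number_def using fin mem by (intro Min_in) auto
  then show "n \<le> 2 * class_indeque_number K4_minor_free_graphs n"
    using pair_graph.indeque_number_ge_half by (auto simp: K4_minor_free_graphs_def)
  have "class_indeque_number K4_minor_free_graphs n \<le> indeque_number (disjoint_4_cycles n)"
    unfolding class_indeque_number_def using fin mem by (rule Min_le)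
  then show "2 * class_indeque_number K4_minor_free_graphs n \<le> n + 3"
    using indeque_number_disjoint_4_cycles[of n] by linarith
qed

theorem theorem1p5:
  shows "(\<lambda>n. real (class_indeque_number K4_minor_free_graphs n) / real n) \<longlonglongrightarrow> 1 / 2
    \<and> indeque_ratio K4_minor_free_graphs = 1 / 2"
proof -
  let ?c = "class_indeque_number K4_minor_free_graphs"
  have lower: "eventually (\<lambda>n. 1 / 2 \<le> real (?c n) / real n) sequentially"
    using eventually_gt_at_top[of 0]
  proof eventually_elim
    case (elim n)
    have "real n \<le> 2 * real (?c n)" using class_indeque_number_bounds(1)[of n] by linarith
    then show ?case using elim by (simp add: field_simps)
  qed
  have upper: "eventually (\<lambda>n. real (?c n) / real n \<le> 1 / 2 + 3 / 2 * inverse (real n)) sequentially"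
    using eventually_gt_at_top[of 0]
  proof eventually_elim
    case (elim n)
    have "2 * real (?c n) \<le> real n + 3" using class_indeque_number_bounds(2)[of n] by linarith
    then show ?case using elim by (simp add: field_simps)
  qed
  have "(\<lambda>n. 1 / 2 + 3 / 2 * inverse (real n)) \<longlonglongrightarrow> 1 / 2 + 3 / 2 * 0"
    by (intro tendsto_intros lim_inverse_n)
  then have "(\<lambda>n. 1 / 2 + 3 / 2 * inverse (real n)) \<longlonglongrightarrow> 1 / 2" by simp
  then have "(\<lambda>n. real (?c n) / real n) \<longlonglongrightarrow> 1 / 2"
    by (rule tendsto_sandwich[OF lower upper tendsto_const])
  then show ?thesis by (auto simp: indeque_ratio_def limI)
qed

end
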